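(* For every $\alpha\in(0,2)$ there exist constants $\mathcal C_1,\mathcal C_2>0$ such that $\mathbb P(\xi_\alpha^\delta>x)\le \mathcal C_1 e^{-\mathcal C_2\log^2 x}$ for all $x\ge1$ and all $\delta\in[0,1]$.
   Context: $B_\alpha$ is fractional Brownian motion with $\mathrm{Cov}(B_\alpha(t),B_\alpha(s))=\frac{|t|^\alpha+|s|^\alpha-|t-s|^\alpha}{2}$, $t,s\in\mathbb R$. Let $Z_\alpha(t)=\sqrt2B_\alpha(t)-|t|^\alpha$. For $\delta>0$, $\xi_\alpha^\delta=\dfrac{\sup_{t\in\delta\mathbb Z}e^{Z_\alpha(t)}}{\delta\sum_{t\in\delta\mathbb Z}e^{Z_\alpha(t)}}$; for $\delta=0$, $\xi_\alpha^0=\dfrac{\sup_{t\in\mathbb R}e^{Z_\alpha(t)}}{\int_{\mathbb R}e^{Z_\alpha(t)}\,dt}$. *)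

theory Defs
  imports "HOL-Probability.Probability"
begin

definition fbm_cov :: "real \<Rightarrow> real \<Rightarrow> real \<Rightarrow> real" where
  "fbm_cov \<alpha> t s = (\<bar>t\<bar> powr \<alpha> + \<bar>s\<bar> powr \<alpha> - \<bar>t - s\<bar> powr \<alpha>) / 2"

text \<open>B is a fractional Brownian motion (indexed by all of R) on the probability space M:
  a centered Gaussian process with covariance fbm_cov alpha and continuous sample paths.
  Gaussianity: every finite linear combination of values is a centered normal random
  variable (possibly degenerate) with the prescribed variance, expressed through its
  characteristic function.\<close>
definition is_fBm :: "'a measure \<Rightarrow> real \<Rightarrow> (real \<Rightarrow> 'a \<Rightarrow> real) \<Rightarrow> bool" where
  "is_fBm M \<alpha> B \<longleftrightarrow>
     prob_space M \<and>
     (\<forall>t. B t \<in> borel_measurable M) \<and>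
     (\<forall>\<omega>\<in>space M. continuous_on UNIV (\<lambda>t. B t \<omega>)) \<and>
     (\<forall>(T::real set) (c::real \<Rightarrow> real). finite T \<longrightarrow>
        (\<forall>\<theta>. char (distr M borel (\<lambda>\<omega>. \<Sum>t\<in>T. c t * B t \<omega>)) \<theta> =
              complex_of_real (exp (- (\<Sum>s\<in>T. \<Sum>t\<in>T. c s * c t * fbm_cov \<alpha> s t) * \<theta>\<^sup>2 / 2))))"

definition Zfbm :: "real \<Rightarrow> (real \<Rightarrow> 'a \<Rightarrow> real) \<Rightarrow> real \<Rightarrow> 'a \<Rightarrow> real" where
  "Zfbm \<alpha> B t \<omega> = sqrt 2 * B t \<omega> - \<bar>t\<bar> powr \<alpha>"

definition xi :: "real \<Rightarrow> (real \<Rightarrow> 'a \<Rightarrow> real) \<Rightarrow> real \<Rightarrow> 'a \<Rightarrow> real" where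
  "xi \<alpha> B \<delta> \<omega> =
     (if \<delta> = 0 then
        Sup ((\<lambda>t. exp (Zfbm \<alpha> B t \<omega>)) ` UNIV) / integral\<^sup>L lborel (\<lambda>t. exp (Zfbm \<alpha> B t \<omega>))
      else
        Sup ((\<lambda>k::int. exp (Zfbm \<alpha> B (\<delta> * of_int k) \<omega>)) ` UNIV) /
          (\<delta> * infsum (\<lambda>k::int. exp (Zfbm \<alpha> B (\<delta> * of_int k) \<omega>)) UNIV))"

end

theory Submission
  imports Defs
begin

text \<open>
  If \<^term>\<open>xi \<alpha> B \<delta> \<omega>\<close> exceeds \<^term>\<open>x\<close>, there is a point \<^term>\<open>t\<close> at which \<^term>\<open>Zfbm \<alpha> B\<close> is at
  least its value at 0 and \<open>exp Z\<close> is more than \<^term>\<open>x\<close> times the integral or Riemann sum. Lebesgue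
  measure, as well as \<open>\<delta>\<close> times the counting measure on the grid, gives each unit interval mass at
  least 1/2, so \<^term>\<open>Zfbm \<alpha> B\<close> must drop by \<^term>\<open>ln x - ln 2\<close> within a unit interval around \<^term>\<open>t\<close>.

  Suppose that the interval lies at distance \<open>n\<close> from 0, that the increment of \<open>B\<close> from 0 to its
  inner endpoint is at most \<open>u (1 + n)\<^bsup>\<alpha>/2\<^esup>\<close>, and that the dyadic increments of \<open>B\<close> in it at level
  \<open>j\<close> are at most \<open>u 2\<^bsup>-j\<alpha>/4\<^esup>\<close>. By chaining \<open>B\<close> oscillates there by \<open>O(u)\<close>, while
  \<open>|t|\<^bsup>\<alpha>\<^esup>\<close> changes by \<open>O((1 + n)\<^bsup>\<alpha>/2\<^esup>)\<close>. The first property of \<open>t\<close> forces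
  \<open>(1 + n)\<^bsup>\<alpha>/2\<^esup> = O(u)\<close>, and then the drop forces \<open>ln x = O(u)\<close>. Taking \<open>u\<^sup>2\<close> a small multiple of
  \<open>(1 + n)\<^bsup>\<alpha>\<^esup> + (ln x)\<^sup>2\<close> makes this impossible, the Gaussian tails bound the probability that the
  increment bounds fail by \<open>C exp (-c u\<^sup>2)\<close>, and these bounds are summable over \<open>n\<close>.
\<close>

section \<open>Measurability of suprema, sums and continuous processes\<close>

text \<open>A real supremum is by definition the least upper bound of a set, so sets with the same
  upper bounds have the same \<open>Sup\<close>, bounded or not. A bound on the dense rationals
  extends to all reals because sublevel sets of a continuous function are closed.\<close>

lemma Sup_image_Rats_eq_Sup_range:
  fixes f :: "real \<Rightarrow> real"
  assumes "continuous_on UNIV f"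
  shows "Sup (f ` \<rat>) = Sup (range f)"
proof -
  have "(\<forall>t. f t \<le> z) \<longleftrightarrow> (\<forall>t\<in>\<rat>. f t \<le> z)" for z
  proof
    assume le: "\<forall>t\<in>\<rat>. f t \<le> z"
    have "closed {t. f t \<le> z}"
      by (intro closed_Collect_le assms continuous_intros)
    moreover have "\<rat> \<subseteq> {t. f t \<le> z}"
      using le by auto
    ultimately have "closure \<rat> \<subseteq> {t. f t \<le> z}"
      by (rule closure_minimal[rotated])
    then show "\<forall>t. f t \<le> z"
      by (auto simp: Rats_closure_real)
  qed auto
  then show ?thesis
    by (simp add: Sup_real_def)
qed

text \<open>The default value is the same constant for all unbounded sets, so it does not spoil
  measurability.\<close>

lemma Sup_real_not_bdd_above:
  fixes X :: "real set"
  assumes "\<not> bdd_above X"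
  shows "Sup X = (LEAST z. False)"
  proof -
  have "(\<lambda>z. \<forall>x\<in>X. x \<le> z) = (\<lambda>z. False)"
    using assms by (auto simp: bdd_above_def fun_eq_iff)
  then show ?thesis
    unfolding Sup_real_def by simp
qed

lemma pred_bdd_above_image:
  fixes f :: "'i \<Rightarrow> 'a \<Rightarrow> real"
  assumes [simp]: "countable I" and [measurable]: "\<And>i. i \<in> I \<Longrightarrow> f i \<in> borel_measurable M"
  shows "Measurable.pred M (\<lambda>\<omega>. bdd_above ((\<lambda>i. f i \<omega>) ` I))"
proof -
  have "bdd_above ((\<lambda>i. f i \<omega>) ` I) \<longleftrightarrow> (\<exists>N::nat. \<forall>i\<in>I. f i \<omega> \<le> real N)" for \<omega>
    unfolding bdd_above_def by (auto dest: order_trans[OF _ real_nat_ceiling_ge])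
  then show ?thesis
    by simp
qed

text \<open>The event of boundedness is measurable; on it the supremum is an ordinary one, off it a
  constant. No almost sure finiteness has to be shown first.\<close>

lemma borel_measurable_Sup_real:
  fixes f :: "'i \<Rightarrow> 'a \<Rightarrow> real"
  assumes I[simp]: "countable I" and f[measurable]: "\<And>i. i \<in> I \<Longrightarrow> f i \<in> borel_measurable M"
  shows "(\<lambda>\<omega>. Sup ((\<lambda>i. f i \<omega>) ` I)) \<in> borel_measurable M"
proof -
  note [measurable] = pred_bdd_above_image[OF I f]
  \<comment> \<open>Setting the family to 0 off that event makes it bounded at every point, as
    \<open>borel_measurable_cSUP\<close> demands.\<close>
  let ?g = "\<lambda>i \<omega>. if bdd_above ((\<lambda>i. f i \<omega>) ` I) then f i \<omega> else 0"
  have bdd: "bdd_above ((\<lambda>i. ?g i \<omega>) ` I)" for \<omega>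
    by (cases "bdd_above ((\<lambda>i. f i \<omega>) ` I)") auto
  have "(\<lambda>\<omega>. SUP i\<in>I. ?g i \<omega>) \<in> borel_measurable M"
    using bdd by (intro borel_measurable_cSUP) auto
  then have "(\<lambda>\<omega>. if bdd_above ((\<lambda>i. f i \<omega>) ` I) then SUP i\<in>I. ?g i \<omega> else (LEAST z. False))
      \<in> borel_measurable M"
    by measurable
  also have "(\<lambda>\<omega>. if bdd_above ((\<lambda>i. f i \<omega>) ` I) then SUP i\<in>I. ?g i \<omega> else (LEAST z. False)) =
      (\<lambda>\<omega>. Sup ((\<lambda>i. f i \<omega>) ` I))"
    by (auto simp: Sup_real_not_bdd_above)
  finally show ?thesis .
qed

text \<open>For nonnegative terms the sum is the supremum of the countably many finite partial sums
  if these are bounded, and the default 0 otherwise.\<close>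

lemma borel_measurable_infsum_nonneg:
  fixes f :: "'i::countable \<Rightarrow> 'a \<Rightarrow> real"
  assumes [measurable]: "\<And>i. f i \<in> borel_measurable M" and nonneg: "\<And>i \<omega>. 0 \<le> f i \<omega>"
  shows "(\<lambda>\<omega>. infsum (\<lambda>i. f i \<omega>) UNIV) \<in> borel_measurable M"
proof -
  let ?F = "Collect finite :: 'i set set"
  have c: "countable ?F"
    by (rule countable_Collect_finite)
  have m: "(\<lambda>\<omega>. \<Sum>i\<in>F. f i \<omega>) \<in> borel_measurable M" for F
    by measurable
  note [measurable] = pred_bdd_above_image[OF c m] borel_measurable_Sup_real[OF c m]
  have "infsum (\<lambda>i. f i \<omega>) UNIV =
      (if bdd_above ((\<lambda>F. \<Sum>i\<in>F. f i \<omega>) ` ?F) then SUP F\<in>?F. \<Sum>i\<in>F. f i \<omega> else 0)" for \<omega>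
  proof (cases "(\<lambda>i. f i \<omega>) summable_on UNIV")
    case True
    then have "bdd_above ((\<lambda>F. \<Sum>i\<in>F. f i \<omega>) ` ?F)"
      using nonneg by (intro bdd_aboveI2[where M="infsum (\<lambda>i. f i \<omega>) UNIV"] finite_sum_le_infsum[OF True]) auto
    then show ?thesis
      using infsum_nonneg_is_SUPREMUM_real[OF True] nonneg by simp
  next
    case False
    then have "\<not> bdd_above ((\<lambda>F. \<Sum>i\<in>F. f i \<omega>) ` ?F)"
      using nonneg_bdd_above_summable_on[of UNIV "\<lambda>i. f i \<omega>"] nonneg by auto
    then show ?thesis
      using False by (simp add: infsum_not_exists)
  qed
  then show ?thesis
    by simp
qed

lemma floor_mult_divide_bounds:
  fixes c x :: real
  assumes "0 < c"
  shows "x - 1 / c \<le> of_int \<lfloor>c * x\<rfloor> / c" and "of_int \<lfloor>c * x\<rfloor> / c \<le> x"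
proof -
  have "x - 1 / c = (c * x - 1) / c"
    using assms by (simp add: field_simps)
  also have "\<dots> \<le> of_int \<lfloor>c * x\<rfloor> / c"
    using assms by (intro divide_right_mono) linarith+
  finally show "x - 1 / c \<le> of_int \<lfloor>c * x\<rfloor> / c" .
  have "of_int \<lfloor>c * x\<rfloor> / c \<le> c * x / c"
    using assms by (intro divide_right_mono) linarith+
  then show "of_int \<lfloor>c * x\<rfloor> / c \<le> x"
    using assms by simp
qed

text \<open>Rounding time down to a grid leaves countably many time values, which gives joint
  measurability; continuity of paths passes to the limit of finer grids. This makes the integral
  over time a random variable.\<close>

lemma borel_measurable_continuous_process:
  fixes B :: "real \<Rightarrow> 'a \<Rightarrow> real"
  assumes B[measurable]: "\<And>t. B t \<in> borel_measurable M"
    and cont: "\<And>\<omega>. \<omega> \<in> space M \<Longrightarrow> continuous_on UNIV (\<lambda>t. B t \<omega>)"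
  shows "(\<lambda>(\<omega>, t). B t \<omega>) \<in> borel_measurable (M \<Otimes>\<^sub>M lborel)"
proof (rule borel_measurable_LIMSEQ_real)
  fix p assume "p \<in> space (M \<Otimes>\<^sub>M (lborel :: real measure))"
  then have p: "fst p \<in> space M"
    by (auto simp: space_pair_measure)
  have "(\<lambda>n. of_int \<lfloor>real (Suc n) * snd p\<rfloor> / real (Suc n)) \<longlonglongrightarrow> snd p"
  proof (rule tendsto_sandwich)
    show "\<forall>\<^sub>F n in sequentially. snd p - 1 / real (Suc n) \<le> of_int \<lfloor>real (Suc n) * snd p\<rfloor> / real (Suc n)"
      by (intro always_eventually allI floor_mult_divide_bounds) simp
    show "\<forall>\<^sub>F n in sequentially. of_int \<lfloor>real (Suc n) * snd p\<rfloor> / real (Suc n) \<le> snd p"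
      by (intro always_eventually allI floor_mult_divide_bounds) simp
    show "(\<lambda>n. snd p - 1 / real (Suc n)) \<longlonglongrightarrow> snd p"
      using tendsto_diff[OF tendsto_const LIMSEQ_inverse_real_of_nat] by (simp add: inverse_eq_divide)
  qed simp
  then show "(\<lambda>n. B (of_int \<lfloor>real (Suc n) * snd p\<rfloor> / real (Suc n)) (fst p)) \<longlonglongrightarrow> (case p of (\<omega>, t) \<Rightarrow> B t \<omega>)"
    using continuous_on_tendsto_compose[OF cont[OF p]] by (simp add: case_prod_beta)
next
  fix n :: nat
  have "(\<lambda>p. B (of_int i / real (Suc n)) (fst p)) \<in> borel_measurable (M \<Otimes>\<^sub>M lborel)" for i
    by measurable
  then show "(\<lambda>p. B (of_int \<lfloor>real (Suc n) * snd p\<rfloor> / real (Suc n)) (fst p)) \<in> borel_measurable (M \<Otimes>\<^sub>M lborel)"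
    by (rule measurable_compose_countable) measurable
qed

section \<open>Chaining, tails and elementary estimates\<close>

lemma Sup_divide_greaterD:
  fixes f :: "'b \<Rightarrow> real"
  assumes gt: "Sup (range f) / d > x" and "0 \<le> x" "0 \<le> d"
  shows "\<exists>t. f t > x * d \<and> f t \<ge> f t0"
proof -
  \<comment> \<open>For \<open>d = 0\<close> the quotient is 0 and cannot exceed
    \<open>x\<close>.\<close>
  have "d > 0"
    using assms by (cases "d = 0") auto
  then have Sup: "Sup (range f) > x * d"
    using gt by (simp add: pos_less_divide_eq)
  obtain t where t: "f t > x * d"
  proof (cases "bdd_above (range f)")
    case True
    then show ?thesis
      using Sup that by (auto simp: less_cSup_iff)
  next
    \<comment> \<open>Here the supremum is a junk value, but the conclusion does not refer to it.\<close>
    case False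
    then show ?thesis
      using that by (meson bdd_aboveI2 not_le)
  qed
  \<comment> \<open>If \<open>f t\<close> lies below \<open>f t0\<close>, then \<open>t0\<close>
    itself is a witness.\<close>
  then show ?thesis
    by (cases "f t \<ge> f t0") (auto intro: exI[of _ t] exI[of _ t0])
qed

text \<open>Passing from a point of level \<open>Suc j\<close> to its parent \<open>k div 2\<close>
  of level \<open>j\<close> costs at most one increment of level \<open>Suc j\<close>.\<close>

lemma chaining_dyadic:
  fixes f :: "real \<Rightarrow> real"
  assumes incr: "\<And>j k. k < 2 ^ j \<Longrightarrow> \<bar>f (real (k + 1) / 2 ^ j) - f (real k / 2 ^ j)\<bar> \<le> u * r ^ j"
    and "0 \<le> r"
  shows "k \<le> 2 ^ j \<Longrightarrow> \<bar>f (real k / 2 ^ j) - f 0\<bar> \<le> u * (\<Sum>i\<le>j. r ^ i)"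
proof (induction j arbitrary: k)
  case 0
  have "0 \<le> u"
    using incr[of 0 0] by simp
  moreover have "k = 0 \<or> k = 1"
    using 0 by auto
  ultimately show ?case
    using incr[of 0 0] by auto
next
  case (Suc j)
  have u: "0 \<le> u"
    using incr[of 0 0] by simp
  let ?m = "k div 2"
  have IH: "\<bar>f (real ?m / 2 ^ j) - f 0\<bar> \<le> u * (\<Sum>i\<le>j. r ^ i)"
    using Suc.prems by (intro Suc.IH) simp
  have eq: "real ?m / 2 ^ j = real (2 * ?m) / 2 ^ Suc j"
    by simp
  have "\<bar>f (real k / 2 ^ Suc j) - f (real ?m / 2 ^ j)\<bar> \<le> u * r ^ Suc j"
  proof (cases "even k")
    case True
    then have "real k / 2 ^ Suc j = real ?m / 2 ^ j"
      by (auto elim!: evenE)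
    then show ?thesis
      using u \<open>0 \<le> r\<close> by simp
  next
    case False
    then have k: "k = 2 * ?m + 1"
      by simp
    have "\<bar>f (real (2 * ?m + 1) / 2 ^ Suc j) - f (real (2 * ?m) / 2 ^ Suc j)\<bar> \<le> u * r ^ Suc j"
      using Suc.prems k by (intro incr) linarith
    then show ?thesis
      unfolding eq k[symmetric] .
  qed
  with IH show ?case
    by (simp add: distrib_left)
qed

text \<open>The dyadic bounds are dominated by the full geometric series; dyadic approximation from
  below and continuity reach every \<open>\<tau>\<close>.\<close>

lemma chaining:
  fixes f :: "real \<Rightarrow> real"
  assumes cont: "continuous_on UNIV f"
    and incr: "\<And>j k. k < 2 ^ j \<Longrightarrow> \<bar>f (real (k + 1) / 2 ^ j) - f (real k / 2 ^ j)\<bar> \<le> u * r ^ j"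
    and r: "0 \<le> r" "r < 1" and \<tau>: "0 \<le> \<tau>" "\<tau> \<le> 1"
  shows "\<bar>f \<tau> - f 0\<bar> \<le> u / (1 - r)"
proof -
  have u: "0 \<le> u"
    using incr[of 0 0] by simp
  let ?k = "\<lambda>j. nat \<lfloor>2 ^ j * \<tau>\<rfloor>"
  have k: "real (?k j) = of_int \<lfloor>2 ^ j * \<tau>\<rfloor>" for j
    using \<tau> by simp
  have "(\<lambda>j. real (?k j) / 2 ^ j) \<longlonglongrightarrow> \<tau>"
  proof (rule tendsto_sandwich)
    show "\<forall>\<^sub>F j in sequentially. \<tau> - (1 / 2) ^ j \<le> real (?k j) / 2 ^ j"
      unfolding k power_one_over by (intro always_eventually allI floor_mult_divide_bounds) simp
    show "\<forall>\<^sub>F j in sequentially. real (?k j) / 2 ^ j \<le> \<tau>"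
      unfolding k power_one_over by (intro always_eventually allI floor_mult_divide_bounds) simp
    show "(\<lambda>j. \<tau> - (1 / 2) ^ j) \<longlonglongrightarrow> \<tau>"
      using tendsto_diff[OF tendsto_const LIMSEQ_realpow_zero[of "1 / 2"], of \<tau>] by simp
  qed simp
  then have lim: "(\<lambda>j. \<bar>f (real (?k j) / 2 ^ j) - f 0\<bar>) \<longlonglongrightarrow> \<bar>f \<tau> - f 0\<bar>"
    by (intro tendsto_intros continuous_on_tendsto_compose[OF cont]) auto
  have "\<bar>f (real (?k j) / 2 ^ j) - f 0\<bar> \<le> u / (1 - r)" for j
  proof -
    have "?k j \<le> 2 ^ j"
    proof -
      have "2 ^ j * \<tau> \<le> 2 ^ j"
        using \<tau> by simp
      then have "real (?k j) \<le> 2 ^ j"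
        unfolding k by linarith
      then show ?thesis
        by (metis of_nat_le_iff of_nat_numeral of_nat_power)
    qed
    then have "\<bar>f (real (?k j) / 2 ^ j) - f 0\<bar> \<le> u * (\<Sum>i\<le>j. r ^ i)"
      using chaining_dyadic[of f u r] incr r by blast
    also have "(\<Sum>i\<le>j. r ^ i) \<le> (\<Sum>i. r ^ i)"
      using r by (intro sum_le_suminf summable_geometric) auto
    also have "(\<Sum>i. r ^ i) = 1 / (1 - r)"
      using r by (intro suminf_geometric) auto
    finally show ?thesis
      using u by (simp add: mult_left_mono)
  qed
  then show ?thesis
    using lim by (intro LIMSEQ_le_const2[OF lim]) auto
qed

text \<open>Half of the exponent is bounded by its value at \<open>a\<close>; the other half is, up
  to the factor \<open>sqrt 2\<close>, the normal density of variance 2, whose integral is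
  1.\<close>

lemma std_normal_tail:
  "measure std_normal_distribution {x. \<bar>x\<bar> > a} \<le> 2 * exp (- a\<^sup>2 / 4)" if "0 \<le> a"
proof -
  let ?n = "normal_density 0 (sqrt 2)"
  have le: "std_normal_density x * indicator {x. \<bar>x\<bar> > a} x \<le> sqrt 2 * exp (- a\<^sup>2 / 4) * ?n x" for x
  proof (cases "\<bar>x\<bar> > a")
    case True
    then have "a\<^sup>2 \<le> x\<^sup>2"
      using that by (metis abs_le_square_iff abs_of_nonneg less_imp_le)
    then have "exp (- x\<^sup>2 / 2) \<le> exp (- a\<^sup>2 / 4) * exp (- x\<^sup>2 / 4)"
      by (simp flip: exp_add)
    then have "exp (- x\<^sup>2 / 2) * (1 / sqrt (2 * pi)) \<le> exp (- a\<^sup>2 / 4) * exp (- x\<^sup>2 / 4) * (1 / sqrt (2 * pi))"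
      by (intro mult_right_mono) auto
    also have "\<dots> = sqrt 2 * exp (- a\<^sup>2 / 4) * ?n x"
      by (simp add: normal_density_def real_sqrt_mult field_simps)
    finally show ?thesis
      using True by (simp add: normal_density_def)
  next
    case False
    then show ?thesis
      by simp
  qed
  have "emeasure std_normal_distribution {x. \<bar>x\<bar> > a} =
      (\<integral>\<^sup>+x. ennreal (std_normal_density x) * indicator {x. \<bar>x\<bar> > a} x \<partial>lborel)"
    by (subst emeasure_density) auto
  also have "\<dots> = (\<integral>\<^sup>+x. ennreal (std_normal_density x * indicator {x. \<bar>x\<bar> > a} x) \<partial>lborel)"
    by (intro nn_integral_cong) (auto simp: indicator_def)
  also have "\<dots> \<le> (\<integral>\<^sup>+x. ennreal (sqrt 2 * exp (- a\<^sup>2 / 4) * ?n x) \<partial>lborel)"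
    by (intro nn_integral_mono ennreal_leI le)
  also have "\<dots> = ennreal (\<integral>x. sqrt 2 * exp (- a\<^sup>2 / 4) * ?n x \<partial>lborel)"
    by (intro nn_integral_eq_integral) (auto simp: normal_density_nonneg)
  also have "\<dots> = ennreal (sqrt 2 * exp (- a\<^sup>2 / 4))"
    by simp
  finally have "measure std_normal_distribution {x. \<bar>x\<bar> > a} \<le> sqrt 2 * exp (- a\<^sup>2 / 4)"
    unfolding measure_def by (simp add: enn2real_leI)
  also have "\<dots> \<le> 2 * exp (- a\<^sup>2 / 4)"
    by (simp add: sqrt_le_D real_le_lsqrt)
  finally show ?thesis .
qed

section \<open>Countable union bounds and convergent series\<close>

lemma (in finite_measure) measure_UN_le_suminf:
  assumes "\<And>i::nat. A i \<in> sets M" "\<And>i. measure M (A i) \<le> f i" "summable f"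
  shows "measure M (\<Union>i. A i) \<le> suminf f"
proof -
  have sm: "summable (\<lambda>i. measure M (A i))"
    using assms by (intro summable_comparison_test[OF _ assms(3)]) auto
  have "measure M (\<Union>i. A i) \<le> (\<Sum>i. measure M (A i))"
    using assms by (intro finite_measure_subadditive_countably sm) auto
  also have "\<dots> \<le> suminf f"
    using assms by (intro suminf_le sm) auto
  finally show ?thesis .
qed

lemma exp_minus_le_fact_divide_power:
  fixes y :: real
  assumes "0 < y"
  shows "exp (- y) \<le> fact p / y ^ p"
proof -
  have "y ^ p / fact p \<le> (\<Sum>n. y ^ n / fact n)"
    using assms sum_le_suminf[OF summable_exp_generic[of y], of "{p}"]
    by (simp add: divide_inverse mult.commute)
  also have "\<dots> = exp y"
    by (simp add: exp_def divide_inverse mult.commute)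
  finally show ?thesis
    using assms by (simp add: exp_minus field_simps)
qed

text \<open>This is the cost of a union bound over the \<open>2 ^ j\<close> increments of each
  level. A power \<open>p\<close> with \<open>q ^ p > 4\<close> gives decay \<open>4 ^ j\<close>,
  which beats the count and leaves a geometric series.\<close>

lemma summable_power_mult_exp_minus_power:
  fixes q :: real
  assumes "1 < q"
  shows "summable (\<lambda>j. 2 * 2 ^ j * exp (- (q ^ j / 8)))"
proof -
  obtain p where p: "4 < q ^ p"
    using real_arch_pow[OF assms] by blast
  have "2 * 2 ^ j * exp (- (q ^ j / 8)) \<le> 2 * fact p * 8 ^ p * (1 / 2) ^ j" for j
  proof -
    have "exp (- (q ^ j / 8)) \<le> fact p / (q ^ j / 8) ^ p"
      using assms by (intro exp_minus_le_fact_divide_power) simp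
    also have "(q ^ j / 8) ^ p = (q ^ p) ^ j / 8 ^ p"
      by (simp add: power_divide mult.commute flip: power_mult)
    also have "fact p / ((q ^ p) ^ j / 8 ^ p) \<le> fact p / (4 ^ j / 8 ^ p)"
      using p by (intro divide_left_mono divide_right_mono power_mono) auto
    finally have "2 * 2 ^ j * exp (- (q ^ j / 8)) \<le> 2 * 2 ^ j * (fact p / (4 ^ j / 8 ^ p))"
      by (intro mult_left_mono) auto
    also have "(4::real) ^ j = 2 ^ j * 2 ^ j"
      by (simp flip: power_mult_distrib)
    also have "2 * 2 ^ j * (fact p / (2 ^ j * 2 ^ j / 8 ^ p)) = 2 * fact p * 8 ^ p * (1 / 2 :: real) ^ j"
      by (simp add: power_divide)
    finally show ?thesis .
  qed
  then show ?thesis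
    by (intro summable_comparison_test[OF _ summable_mult[OF summable_geometric[of "1 / 2 :: real"],
          of "2 * fact p * 8 ^ p"]]) auto
qed

text \<open>With \<open>p * \<alpha> > 2\<close> the terms are dominated by a multiple of the
  inverse squares.\<close>

lemma summable_exp_minus_powr:
  fixes c \<alpha> :: real
  assumes "0 < c" "0 < \<alpha>"
  shows "summable (\<lambda>n. exp (- (c * (1 + real n) powr \<alpha>)))"
proof -
  obtain p :: nat where p: "2 / \<alpha> < p"
    using reals_Archimedean2 by blast
  have "exp (- (c * (1 + real n) powr \<alpha>)) \<le> fact p / c ^ p * (1 / (real (Suc n)) ^ 2)" for n
  proof -
    have "exp (- (c * (1 + real n) powr \<alpha>)) \<le> fact p / (c * (1 + real n) powr \<alpha>) ^ p"
      using assms by (intro exp_minus_le_fact_divide_power) (simp add: powr_gt_zero)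
    also have "(c * (1 + real n) powr \<alpha>) ^ p = c ^ p * (1 + real n) powr (p * \<alpha>)"
      by (simp add: power_mult_distrib powr_power mult.commute)
    also have "fact p / (c ^ p * (1 + real n) powr (p * \<alpha>)) \<le> fact p / (c ^ p * (1 + real n) powr 2)"
      using assms p by (intro divide_left_mono mult_left_mono powr_mono) (auto simp: field_simps powr_gt_zero)
    also have "\<dots> = fact p / c ^ p * (1 / (real (Suc n)) ^ 2)"
      by (simp add: powr_numeral)
    finally show ?thesis .
  qed
  moreover have sm: "summable (\<lambda>n. fact p / c ^ p * (1 / (real (Suc n)) ^ 2))"
    using inverse_power_summable[of 2, where 'a=real]
    by (intro summable_mult, subst summable_Suc_iff) (simp add: inverse_eq_divide)
  ultimately show ?thesis
    by (intro summable_comparison_test[OF _ sm]) auto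
qed

section \<open>Growth of powers and unit intervals\<close>

text \<open>The fractions \<open>x / (1 + x)\<close> and \<open>1 / (1 + x)\<close> add up to 1, and
  an exponent of at most 1 can only enlarge numbers in the unit interval.\<close>

lemma powr_add_one_le:
  fixes x \<beta> :: real
  assumes "0 \<le> x" "0 \<le> \<beta>" "\<beta> \<le> 1"
  shows "(1 + x) powr \<beta> \<le> x powr \<beta> + 1"
proof -
  let ?y = "1 + x"
  have "x / ?y \<le> (x / ?y) powr \<beta>" "1 / ?y \<le> (1 / ?y) powr \<beta>"
    using assms powr_mono'[of \<beta> 1 "x / ?y"] powr_mono'[of \<beta> 1 "1 / ?y"] by auto
  moreover have "x / ?y + 1 / ?y = 1"
    using assms by (simp add: field_simps)
  ultimately have "1 \<le> x powr \<beta> / ?y powr \<beta> + 1 / ?y powr \<beta>"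
    using assms by (simp add: powr_divide)
  then have "1 \<le> (x powr \<beta> + 1) / ?y powr \<beta>"
    by (simp add: add_divide_distrib)
  then show ?thesis
    using assms by (simp add: le_divide_eq split: if_splits)
qed

text \<open>A difference of squares: since \<open>\<alpha> / 2 \<le> 1\<close>, the first factor is
  at most 1. The drift thus varies over a unit interval only on the scale of the standard deviation
  of \<open>B\<close> there.\<close>

lemma powr_add_one_diff_le:
  fixes x \<alpha> :: real
  assumes "0 \<le> x" "0 \<le> \<alpha>" "\<alpha> \<le> 2"
  shows "(1 + x) powr \<alpha> - x powr \<alpha> \<le> 2 * (1 + x) powr (\<alpha> / 2)"
proof -
  let ?a = "(1 + x) powr (\<alpha> / 2)" and ?b = "x powr (\<alpha> / 2)"
  have "(1 + x) powr \<alpha> - x powr \<alpha> = (?a - ?b) * (?a + ?b)"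
    by (simp add: algebra_simps flip: powr_add)
  also have "\<dots> \<le> 1 * (?a + ?a)"
    using assms powr_add_one_le[of x "\<alpha> / 2"] powr_mono2[of "\<alpha> / 2" x "1 + x"]
    by (intro mult_mono) auto
  finally show ?thesis
    by simp
qed

lemma unit_interval_cover:
  fixes t :: real
  obtains \<sigma> a :: real and n :: nat where "\<sigma> \<in> {1, -1}" "t \<in> {a..a + 1}"
    "\<And>s. s \<in> {a..a + 1} \<Longrightarrow> \<exists>\<tau>\<in>{0..1}. s = \<sigma> * (real n + \<tau>)"
proof (cases "t \<ge> 0")
  case True
  define n where "n = nat \<lfloor>t\<rfloor>"
  have "real n = of_int \<lfloor>t\<rfloor>"
    using True by (simp add: n_def)
  then have "t \<in> {real n..real n + 1}"
    unfolding atLeastAtMost_iff by linarith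
  moreover have "\<exists>\<tau>\<in>{0..1}. s = 1 * (real n + \<tau>)" if "s \<in> {real n..real n + 1}" for s
    using that by (intro bexI[of _ "s - real n"]) auto
  ultimately show ?thesis
    by (intro that[of 1 "real n" n]) auto
next
  case False
  define n where "n = nat \<lfloor>- t\<rfloor>"
  have "real n = of_int \<lfloor>- t\<rfloor>"
    using False by (simp add: n_def)
  then have "t \<in> {- real n - 1..- real n - 1 + 1}"
    unfolding atLeastAtMost_iff by linarith
  moreover have "\<exists>\<tau>\<in>{0..1}. s = - 1 * (real n + \<tau>)" if "s \<in> {- real n - 1..- real n - 1 + 1}" for s
    using that by (intro bexI[of _ "- s - real n"]) auto
  ultimately show ?thesis
    by (intro that[of "-1" "- real n - 1" n]) auto
qed

text \<open>The count exceeds \<open>1 / \<delta> - 1\<close> and is at least 1, hence is at least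
  the mean of these two bounds.\<close>

lemma grid_points_in_unit_interval:
  fixes a \<delta> :: real
  assumes "0 < \<delta>" "\<delta> \<le> 1"
  shows "1 / 2 \<le> \<delta> * real (card {k::int. \<delta> * of_int k \<in> {a..a + 1}})"
    and "finite {k::int. \<delta> * of_int k \<in> {a..a + 1}}"
proof -
  have eq: "{k::int. \<delta> * of_int k \<in> {a..a + 1}} = {\<lceil>a / \<delta>\<rceil>..\<lfloor>(a + 1) / \<delta>\<rfloor>}"
    using assms by (auto simp: ceiling_le_iff le_floor_iff field_simps)
  show "finite {k::int. \<delta> * of_int k \<in> {a..a + 1}}"
    unfolding eq by simp
  let ?d = "\<lfloor>(a + 1) / \<delta>\<rfloor> - \<lceil>a / \<delta>\<rceil> + 1"
  have "1 \<le> 1 / \<delta>"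
    using assms by simp
  have gt: "1 / \<delta> - 1 < of_int ?d"
    by (simp add: add_divide_distrib) linarith
  then have "0 < ?d"
    using \<open>1 \<le> 1 / \<delta>\<close> by linarith
  then have "1 \<le> real_of_int ?d"
    by linarith
  moreover have "y / 2 \<le> d" if "1 \<le> d" "y - 1 < d" for y d :: real
    using that by linarith
  ultimately have "1 / \<delta> / 2 \<le> of_int ?d"
    using gt by blast
  also have "of_int ?d = real (card {k::int. \<delta> * of_int k \<in> {a..a + 1}})"
    using \<open>0 < ?d\<close> unfolding eq by simp
  finally show "1 / 2 \<le> \<delta> * real (card {k::int. \<delta> * of_int k \<in> {a..a + 1}})"
    using assms by (simp add: field_simps)
qed

section \<open>Fractional Brownian motion\<close>

text \<open>Increments of level j have standard deviation 2^(-j \<alpha> / 2). Allowing the square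
  root of this decay puts the threshold at 2^(j \<alpha> / 4) standard deviations times u, yet the
  thresholds still form a convergent geometric series.\<close>

definition chain_rate :: "real \<Rightarrow> real" where
  "chain_rate \<alpha> = 2 powr (- \<alpha> / 4)"

text \<open>The 2 pays for the increment from the origin, the series for the dyadic increments of
  all levels.\<close>

definition tail_const :: "real \<Rightarrow> real" where
  "tail_const \<alpha> = 2 + (\<Sum>j. 2 * 2 ^ j * exp (- ((2 powr (\<alpha> / 2)) ^ j / 8)))"

definition drift_const :: "real \<Rightarrow> real" where
  "drift_const \<alpha> = sqrt 2 * (1 + 1 / (1 - chain_rate \<alpha>)) + 2"

text \<open>The summands stand for the mass 1/2 of a unit interval, the increments of
  \<open>B\<close> at two points relative to the inner endpoint, and the variation of the
  drift.\<close>

definition osc_const :: "real \<Rightarrow> real" where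
  "osc_const \<alpha> = ln 2 + 2 * sqrt 2 / (1 - chain_rate \<alpha>) + 2 * drift_const \<alpha>"

locale fBm = prob_space M for M :: "'a measure" +
  fixes \<alpha> :: real and B :: "real \<Rightarrow> 'a \<Rightarrow> real"
  assumes fBm: "is_fBm M \<alpha> B" and \<alpha>_pos: "0 < \<alpha>" and \<alpha>_less_2: "\<alpha> < 2"
begin

lemma measurable_B[measurable]: "B t \<in> borel_measurable M"
  using fBm by (simp add: is_fBm_def)

lemma continuous_B: "\<omega> \<in> space M \<Longrightarrow> continuous_on UNIV (\<lambda>t. B t \<omega>)"
  using fBm by (simp add: is_fBm_def)

lemma continuous_Zfbm: "\<omega> \<in> space M \<Longrightarrow> continuous_on UNIV (\<lambda>t. Zfbm \<alpha> B t \<omega>)"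
  unfolding Zfbm_def using \<alpha>_pos
  by (intro continuous_intros continuous_B continuous_on_powr') auto

lemma measurable_Zfbm[measurable]: "Zfbm \<alpha> B t \<in> borel_measurable M"
  unfolding Zfbm_def by measurable

section \<open>Gaussian tails of increments\<close>

lemma char_B:
  "finite T \<Longrightarrow> char (distr M borel (\<lambda>\<omega>. \<Sum>t\<in>T. c t * B t \<omega>)) \<theta> =
    complex_of_real (exp (- (\<Sum>s\<in>T. \<Sum>t\<in>T. c s * c t * fbm_cov \<alpha> s t) * \<theta>\<^sup>2 / 2))"
  using fBm unfolding is_fBm_def by blast

text \<open>Divided by its standard deviation, the increment has the standard normal characteristic
  function, so Levy's uniqueness theorem identifies its law.\<close>

lemma increment_tail:
  assumes "0 \<le> a"
  shows "prob {\<omega> \<in> space M. \<bar>B t \<omega> - B s \<omega>\<bar> > a} \<le> 2 * exp (- a\<^sup>2 / (4 * \<bar>t - s\<bar> powr \<alpha>))"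
proof (cases "s = t")
  case True
  have "prob {\<omega> \<in> space M. \<bar>B t \<omega> - B s \<omega>\<bar> > a} \<le> 1"
    by (rule prob_le_1)
  \<comment> \<open>Division by zero turns the exponent into 0, so the bound is 2.\<close>
  also have "1 \<le> 2 * exp (- a\<^sup>2 / (4 * \<bar>t - s\<bar> powr \<alpha>))"
    using True by simp
  finally show ?thesis .
next
  case False
  define \<sigma> where "\<sigma> = \<bar>t - s\<bar> powr (\<alpha> / 2)"
  have \<sigma>: "\<sigma> > 0" and \<sigma>2: "\<sigma>\<^sup>2 = \<bar>t - s\<bar> powr \<alpha>"
    using False by (auto simp: \<sigma>_def power2_eq_square simp flip: powr_add)
  let ?c = "\<lambda>r. if r = t then 1 / \<sigma> else - 1 / \<sigma>"
  let ?X = "\<lambda>\<omega>. \<Sum>r\<in>{s, t}. ?c r * B r \<omega>"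
  have X: "?X \<omega> = (B t \<omega> - B s \<omega>) / \<sigma>" for \<omega>
    using False by (simp add: diff_divide_distrib)
  have "(\<Sum>p\<in>{s, t}. \<Sum>q\<in>{s, t}. ?c p * ?c q * fbm_cov \<alpha> p q) = \<bar>t - s\<bar> powr \<alpha> / \<sigma>\<^sup>2"
  proof -
    have "fbm_cov \<alpha> t s = fbm_cov \<alpha> s t"
      by (simp add: fbm_cov_def abs_minus_commute)
    moreover have "\<bar>t - s\<bar> powr \<alpha> = fbm_cov \<alpha> s s + fbm_cov \<alpha> t t - 2 * fbm_cov \<alpha> s t"
      using \<alpha>_pos by (simp add: fbm_cov_def abs_minus_commute[of s t] field_simps)
    ultimately show ?thesis
      using False by (simp add: power2_eq_square diff_divide_distrib add_divide_distrib)
  qed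
  also have "\<dots> = 1"
    using \<sigma> by (simp flip: \<sigma>2)
  finally have var: "(\<Sum>p\<in>{s, t}. \<Sum>q\<in>{s, t}. ?c p * ?c q * fbm_cov \<alpha> p q) = 1" .
  have "char (distr M borel ?X) \<theta> = exp (- 1 * \<theta>\<^sup>2 / 2)" for \<theta>
    using char_B[of "{s, t}" ?c \<theta>] unfolding var by blast
  then have "char (distr M borel ?X) = char std_normal_distribution"
    by (simp add: char_std_normal_distribution fun_eq_iff)
  then have distr: "distr M borel ?X = std_normal_distribution"
    by (intro Levy_uniqueness real_distribution_distr real_dist_normal_dist) auto
  have "{\<omega> \<in> space M. \<bar>B t \<omega> - B s \<omega>\<bar> > a} = ?X -` {x. \<bar>x\<bar> > a / \<sigma>} \<inter> space M"
    using \<sigma> unfolding X by (auto simp: divide_strict_right_mono divide_less_cancel)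
  then have "prob {\<omega> \<in> space M. \<bar>B t \<omega> - B s \<omega>\<bar> > a} = measure (distr M borel ?X) {x. \<bar>x\<bar> > a / \<sigma>}"
    by (subst measure_distr) auto
  also have "\<dots> \<le> 2 * exp (- (a / \<sigma>)\<^sup>2 / 4)"
    unfolding distr using assms \<sigma> by (intro std_normal_tail) simp
  also have "\<dots> = 2 * exp (- a\<^sup>2 / (4 * \<bar>t - s\<bar> powr \<alpha>))"
    by (simp add: power_divide \<sigma>2 mult.commute)
  finally show ?thesis .
qed

section \<open>Measurability of \<open>xi\<close>\<close>

lemma measurable_xi[measurable]: "xi \<alpha> B \<delta> \<in> borel_measurable M"
proof (cases "\<delta> = 0")
  case True
  have "(\<lambda>(\<omega>, t). Zfbm \<alpha> B t \<omega>) \<in> borel_measurable (M \<Otimes>\<^sub>M lborel)"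
    by (intro borel_measurable_continuous_process continuous_Zfbm measurable_Zfbm)
  then have [measurable]: "(\<lambda>p. Zfbm \<alpha> B (snd p) (fst p)) \<in> borel_measurable (M \<Otimes>\<^sub>M lborel)"
    by (simp add: case_prod_beta)
  have [measurable]: "(\<lambda>\<omega>. LINT t|lborel. exp (Zfbm \<alpha> B t \<omega>)) \<in> borel_measurable M"
    by (rule lborel.borel_measurable_lebesgue_integral) (simp add: case_prod_beta)
  have [measurable]: "(\<lambda>\<omega>. Sup ((\<lambda>t. exp (Zfbm \<alpha> B t \<omega>)) ` \<rat>)) \<in> borel_measurable M"
    by (rule borel_measurable_Sup_real[OF countable_rat]) measurable
  \<comment> \<open>The rational supremum agrees with the real one on \<open>space M\<close>, where
    paths are continuous.\<close>
  have "(\<lambda>\<omega>. Sup ((\<lambda>t. exp (Zfbm \<alpha> B t \<omega>)) ` \<rat>) / (LINT t|lborel. exp (Zfbm \<alpha> B t \<omega>)))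
      \<in> borel_measurable M"
    by measurable
  then show ?thesis
    by (rule measurable_cong[THEN iffD1, rotated])
      (auto simp: xi_def True intro!: Sup_image_Rats_eq_Sup_range continuous_intros continuous_Zfbm
        arg_cong2[where f="(/)"])
next
  case False
  have [measurable]:
    "(\<lambda>\<omega>. Sup (range (\<lambda>k::int. exp (Zfbm \<alpha> B (\<delta> * of_int k) \<omega>)))) \<in> borel_measurable M"
    by (rule borel_measurable_Sup_real) auto
  have [measurable]:
    "(\<lambda>\<omega>. infsum (\<lambda>k::int. exp (Zfbm \<alpha> B (\<delta> * of_int k) \<omega>)) UNIV) \<in> borel_measurable M"
    by (rule borel_measurable_infsum_nonneg) auto
  show ?thesis
    using False unfolding xi_def by simp
qed

text \<open>
  The sign \<^term>\<open>\<sigma>\<close> is 1 or -1: the unit intervals are \<open>\<sigma> [n, n + 1]\<close>, so that \<open>\<sigma> n\<close> is always the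
  endpoint closer to 0.
\<close>

definition bad :: "real \<Rightarrow> nat \<Rightarrow> real \<Rightarrow> 'a set" where
  "bad \<sigma> n u =
     {\<omega> \<in> space M. \<bar>B (\<sigma> * real n) \<omega> - B 0 \<omega>\<bar> > u * (1 + real n) powr (\<alpha> / 2)} \<union>
     (\<Union>j. \<Union>k<2 ^ j. {\<omega> \<in> space M. \<bar>B (\<sigma> * (real n + real (k + 1) / 2 ^ j)) \<omega> -
        B (\<sigma> * (real n + real k / 2 ^ j)) \<omega>\<bar> > u * chain_rate \<alpha> ^ j})"

lemma sets_bad[measurable]: "bad \<sigma> n u \<in> sets M"
  unfolding bad_def by measurable

lemma chain_rate_bounds: "0 \<le> chain_rate \<alpha>" "chain_rate \<alpha> < 1"
  using \<alpha>_pos by (auto simp: chain_rate_def powr_less_one)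

lemma prob_bad_le:
  assumes u: "1 \<le> u" and \<sigma>: "\<bar>\<sigma>\<bar> = 1"
  shows "prob (bad \<sigma> n u) \<le> tail_const \<alpha> * exp (- u\<^sup>2 / 8)"
proof -
  define q where "q = 2 powr (\<alpha> / 2)"
  have q: "1 < q"
    using \<alpha>_pos by (simp add: q_def)
  let ?A = "{\<omega> \<in> space M. \<bar>B (\<sigma> * real n) \<omega> - B 0 \<omega>\<bar> > u * (1 + real n) powr (\<alpha> / 2)}"
  let ?C = "\<lambda>j k. {\<omega> \<in> space M. \<bar>B (\<sigma> * (real n + real (k + 1) / 2 ^ j)) \<omega> -
        B (\<sigma> * (real n + real k / 2 ^ j)) \<omega>\<bar> > u * chain_rate \<alpha> ^ j}"
  have A: "prob ?A \<le> 2 * exp (- u\<^sup>2 / 8)"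
  proof -
    have "prob ?A \<le> 2 * exp (- (u * (1 + real n) powr (\<alpha> / 2))\<^sup>2 / (4 * \<bar>\<sigma> * real n - 0\<bar> powr \<alpha>))"
      using u by (intro increment_tail) auto
    also have "(u * (1 + real n) powr (\<alpha> / 2))\<^sup>2 = u\<^sup>2 * (1 + real n) powr \<alpha>"
      by (simp add: power2_eq_square flip: powr_add)
    also have "\<bar>\<sigma> * real n - 0\<bar> = real n"
      using \<sigma> by (simp add: abs_mult)
    finally have le: "prob ?A \<le> 2 * exp (- (u\<^sup>2 * (1 + real n) powr \<alpha>) / (4 * real n powr \<alpha>))" .
    \<comment> \<open>For \<open>n = 0\<close> the increment vanishes and the exponent divides by
      zero, so the event is treated directly.\<close>
    show ?thesis
    proof (cases "n = 0")
      case True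
      then have "?A = {}"
        using u by auto
      then show ?thesis
        unfolding \<open>?A = {}\<close> by simp
    next
      case False
      have "u\<^sup>2 * (real n powr \<alpha>) \<le> u\<^sup>2 * (1 + real n) powr \<alpha>"
        using \<alpha>_pos by (intro mult_left_mono powr_mono2) auto
      then have "u\<^sup>2 / 4 \<le> u\<^sup>2 * (1 + real n) powr \<alpha> / (4 * real n powr \<alpha>)"
        using False by (simp add: le_divide_eq powr_gt_zero)
      moreover have "u\<^sup>2 / 8 \<le> u\<^sup>2 / 4"
        by simp
      ultimately have "exp (- (u\<^sup>2 * (1 + real n) powr \<alpha>) / (4 * real n powr \<alpha>)) \<le> exp (- u\<^sup>2 / 8)"
        by (subst exp_le_cancel_iff) linarith
      with le show ?thesis
        by linarith
    qed
  qed
  \<comment> \<open>The variance is \<open>1 / q ^ (2 * j)\<close> and the squared threshold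
    \<open>u\<^sup>2 / q ^ j\<close>, so their quotient grows like \<open>q ^ j\<close>.\<close>
  have C: "prob (?C j k) \<le> 2 * exp (- (q ^ j / 8)) * exp (- u\<^sup>2 / 8)" for j k
  proof -
    have "prob (?C j k) \<le> 2 * exp (- (u * chain_rate \<alpha> ^ j)\<^sup>2 /
        (4 * \<bar>\<sigma> * (real n + real (k + 1) / 2 ^ j) - \<sigma> * (real n + real k / 2 ^ j)\<bar> powr \<alpha>))"
      using u chain_rate_bounds by (intro increment_tail) auto
    also have "\<bar>\<sigma> * (real n + real (k + 1) / 2 ^ j) - \<sigma> * (real n + real k / 2 ^ j)\<bar> = 1 / 2 ^ j"
      using \<sigma> by (simp add: abs_mult add_divide_distrib flip: right_diff_distrib)
    also have "(1 / 2 ^ j) powr \<alpha> = 1 / (q ^ j * q ^ j)"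
      by (simp add: q_def powr_divide powr_power flip: powr_realpow powr_add) (simp add: powr_powr mult.commute)
    also have "(u * chain_rate \<alpha> ^ j)\<^sup>2 = u\<^sup>2 / q ^ j"
    proof -
      have "(chain_rate \<alpha>)\<^sup>2 = 1 / q"
        by (simp add: chain_rate_def q_def power2_eq_square powr_minus_divide flip: powr_add)
      then show ?thesis
        by (simp add: power_mult_distrib power_divide mult.commute[of j] flip: power_mult)
          (simp add: power_mult power_divide)
    qed
    also have "- (u\<^sup>2 / q ^ j) / (4 * (1 / (q ^ j * q ^ j))) = - (u\<^sup>2 * q ^ j / 4)"
      using q by simp
    \<comment> \<open>As \<open>u\<^sup>2\<close> and \<open>q ^ j\<close> are at least 1, half of
      the exponent dominates each of them: one makes the levels summable, the other is the common
      factor.\<close>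
    also have "exp (- (u\<^sup>2 * q ^ j / 4)) \<le> exp (- (q ^ j / 8) + - u\<^sup>2 / 8)"
    proof -
      have "1 \<le> q ^ j" "1 \<le> u\<^sup>2"
        using q u by (simp_all add: one_le_power)
      then have "u\<^sup>2 * 1 \<le> u\<^sup>2 * q ^ j" "1 * q ^ j \<le> u\<^sup>2 * q ^ j"
        by (intro mult_left_mono mult_right_mono; simp)+
      then show ?thesis
        by simp
    qed
    finally show ?thesis
      by (simp only: exp_add mult.assoc)
  qed
  have level: "prob (\<Union>k<2 ^ j. ?C j k) \<le> 2 * 2 ^ j * exp (- (q ^ j / 8)) * exp (- u\<^sup>2 / 8)" for j
  proof -
    have "prob (\<Union>k<2 ^ j. ?C j k) \<le> (\<Sum>k<2 ^ j. prob (?C j k))"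
      by (intro finite_measure_subadditive_finite) auto
    also have "\<dots> \<le> (\<Sum>k<(2::nat) ^ j. 2 * exp (- (q ^ j / 8)) * exp (- u\<^sup>2 / 8))"
      by (intro sum_mono C)
    finally show ?thesis
      by simp
  qed
  note sm = summable_power_mult_exp_minus_power[OF q]
  have "prob (\<Union>j. \<Union>k<2 ^ j. ?C j k) \<le> (\<Sum>j. 2 * 2 ^ j * exp (- (q ^ j / 8)) * exp (- u\<^sup>2 / 8))"
    by (intro measure_UN_le_suminf level summable_mult2 sm) measurable
  also have "\<dots> = (\<Sum>j. 2 * 2 ^ j * exp (- (q ^ j / 8))) * exp (- u\<^sup>2 / 8)"
    by (rule suminf_mult2[OF sm, symmetric])
  finally have U: "prob (\<Union>j. \<Union>k<2 ^ j. ?C j k) \<le> (\<Sum>j. 2 * 2 ^ j * exp (- (q ^ j / 8))) * exp (- u\<^sup>2 / 8)" .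
  have "prob (bad \<sigma> n u) \<le> prob ?A + prob (\<Union>j. \<Union>k<2 ^ j. ?C j k)"
    unfolding bad_def by (intro measure_Un_le) measurable
  also have "\<dots> \<le> tail_const \<alpha> * exp (- u\<^sup>2 / 8)"
    using A U by (simp add: tail_const_def q_def distrib_right)
  finally show ?thesis .
qed

section \<open>Paths outside the bad events\<close>

lemma not_bad_increment_le:
  assumes \<omega>: "\<omega> \<in> space M" "\<omega> \<notin> bad \<sigma> n u" and \<tau>: "\<tau> \<in> {0..1}"
  shows "\<bar>B (\<sigma> * (real n + \<tau>)) \<omega> - B (\<sigma> * real n) \<omega>\<bar> \<le> u / (1 - chain_rate \<alpha>)"
proof -
  have cont: "continuous_on UNIV (\<lambda>\<tau>. B (\<sigma> * (real n + \<tau>)) \<omega>)"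
    by (rule continuous_on_compose2[OF continuous_B[OF \<omega>(1)]]) (auto intro!: continuous_intros)
  have "\<bar>B (\<sigma> * (real n + real (k + 1) / 2 ^ j)) \<omega> - B (\<sigma> * (real n + real k / 2 ^ j)) \<omega>\<bar>
      \<le> u * chain_rate \<alpha> ^ j" if "k < 2 ^ j" for j k
    using \<omega> that unfolding bad_def by (auto simp: not_less)
  from chaining[OF cont this chain_rate_bounds] \<tau> show ?thesis
    by simp
qed

text \<open>With a = (1 + n)^(\<alpha> / 2), comparison with the value at 0 yields a quadratic
  inequality giving a = O(u), and the drop then gives ln x = O(u). Squaring and adding prepares the
  contradiction for a small multiple as \<open>u\<^sup>2\<close>.\<close>

lemma not_bad_bound:
  assumes \<omega>: "\<omega> \<in> space M" "\<omega> \<notin> bad \<sigma> n u" and \<sigma>: "\<bar>\<sigma>\<bar> = 1" and u: "1 \<le> u" and x: "1 \<le> x"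
    and \<tau>: "\<tau> \<in> {0..1}" "\<tau>' \<in> {0..1}"
    and Z0: "Zfbm \<alpha> B (\<sigma> * (real n + \<tau>)) \<omega> \<ge> Zfbm \<alpha> B 0 \<omega>"
    and Z: "Zfbm \<alpha> B (\<sigma> * (real n + \<tau>)) \<omega> - Zfbm \<alpha> B (\<sigma> * (real n + \<tau>')) \<omega> \<ge> ln x - ln 2"
  shows "(1 + real n) powr \<alpha> + (ln x)\<^sup>2 \<le> ((drift_const \<alpha>)\<^sup>2 + (osc_const \<alpha>)\<^sup>2) * u\<^sup>2"
proof -
  define S where "S = 1 / (1 - chain_rate \<alpha>)"
  define a where "a = (1 + real n) powr (\<alpha> / 2)"
  have S: "0 \<le> S"
    using chain_rate_bounds by (simp add: S_def)
  have a: "1 \<le> a"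
    using \<alpha>_pos by (simp add: a_def ge_one_powr_ge_zero)
  have a2: "(1 + real n) powr \<alpha> = a\<^sup>2"
    by (simp add: a_def power2_eq_square flip: powr_add)
  \<comment> \<open>On the whole unit interval the drift stays in a window of width
    \<open>2 * a\<close>.\<close>
  have drift: "a\<^sup>2 - 2 * a \<le> \<bar>\<sigma> * (real n + r)\<bar> powr \<alpha>" "\<bar>\<sigma> * (real n + r)\<bar> powr \<alpha> \<le> a\<^sup>2"
    if "r \<in> {0..1}" for r
  proof -
    have eq: "\<bar>\<sigma> * (real n + r)\<bar> = real n + r"
      using \<sigma> that by (simp add: abs_mult)
    have "a\<^sup>2 - 2 * a \<le> real n powr \<alpha>"
      using powr_add_one_diff_le[of "real n" \<alpha>] \<alpha>_pos \<alpha>_less_2 by (simp add: a_def[symmetric] a2)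
    also have "\<dots> \<le> (real n + r) powr \<alpha>"
      using that \<alpha>_pos by (intro powr_mono2) auto
    finally show "a\<^sup>2 - 2 * a \<le> \<bar>\<sigma> * (real n + r)\<bar> powr \<alpha>"
      unfolding eq .
    show "\<bar>\<sigma> * (real n + r)\<bar> powr \<alpha> \<le> a\<^sup>2"
      unfolding eq a2[symmetric] using that \<alpha>_pos by (intro powr_mono2) auto
  qed
  have W: "\<bar>B (\<sigma> * (real n + \<tau>)) \<omega> - B (\<sigma> * real n) \<omega>\<bar> \<le> S * u"
    "\<bar>B (\<sigma> * (real n + \<tau>')) \<omega> - B (\<sigma> * real n) \<omega>\<bar> \<le> S * u"
    using not_bad_increment_le[OF \<omega>] \<tau> by (auto simp: S_def)
  have "\<bar>B (\<sigma> * real n) \<omega> - B 0 \<omega>\<bar> \<le> u * a"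
    using \<omega> unfolding bad_def a_def by (auto simp: not_less)
  \<comment> \<open>The factor 1 is raised to \<open>a\<close>, so that \<open>a\<close> can be
    cancelled from the quadratic inequality below.\<close>
  then have "B (\<sigma> * (real n + \<tau>)) \<omega> - B 0 \<omega> \<le> S * u * 1 + u * a"
    using W by linarith
  also have "\<dots> \<le> S * u * a + u * a"
    using S u a by (intro add_right_mono mult_left_mono) auto
  finally have "sqrt 2 * (B (\<sigma> * (real n + \<tau>)) \<omega> - B 0 \<omega>) \<le> sqrt 2 * (S * u * a + u * a)"
    by (intro mult_left_mono) auto
  then have "a\<^sup>2 - 2 * a \<le> sqrt 2 * (S * u * a + u * a)"
    using Z0 drift(1)[OF \<tau>(1)] \<alpha>_pos by (simp add: Zfbm_def right_diff_distrib)
  then have "a * a \<le> (sqrt 2 * (1 + S) * u + 2) * a"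
    by (simp add: power2_eq_square algebra_simps)
  then have "a \<le> sqrt 2 * (1 + S) * u + 2"
    using a by simp
  also have "\<dots> \<le> drift_const \<alpha> * u"
    using u by (simp add: drift_const_def S_def distrib_right)
  finally have 1: "a \<le> drift_const \<alpha> * u" .
  have "sqrt 2 * (B (\<sigma> * (real n + \<tau>)) \<omega> - B (\<sigma> * (real n + \<tau>')) \<omega>) \<le> sqrt 2 * (2 * S * u)"
    using W by (intro mult_left_mono) auto
  then have "ln x \<le> ln 2 + sqrt 2 * (2 * S * u) + 2 * a"
    using Z drift[OF \<tau>(1)] drift[OF \<tau>(2)] by (simp add: Zfbm_def right_diff_distrib)
  also have "\<dots> \<le> ln 2 * u + sqrt 2 * (2 * S * u) + 2 * (drift_const \<alpha> * u)"
    using 1 u S by (intro add_mono mult_left_mono) auto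
  also have "\<dots> = osc_const \<alpha> * u"
    by (simp add: osc_const_def S_def algebra_simps)
  finally have 2: "ln x \<le> osc_const \<alpha> * u" .
  have "a\<^sup>2 \<le> (drift_const \<alpha> * u)\<^sup>2" "(ln x)\<^sup>2 \<le> (osc_const \<alpha> * u)\<^sup>2"
    using 1 2 a x by (auto intro!: power_mono)
  then show ?thesis
    unfolding a2 by (simp add: power_mult_distrib distrib_right)
qed

text \<open>Otherwise \<open>exp Z\<close> exceeds \<open>2 * exp (Z t) / x\<close> on some unit
  interval, whose mass of at least 1/2 makes the denominator too large for the choice of
  \<open>t\<close>. One \<open>t\<close> serves all intervals, so the interval may be chosen
  afterwards.\<close>

lemma xi_greaterD:
  assumes x: "1 \<le> x" and \<delta>: "\<delta> \<in> {0..1}" and gt: "xi \<alpha> B \<delta> \<omega> > x"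
  obtains t where "Zfbm \<alpha> B t \<omega> \<ge> Zfbm \<alpha> B 0 \<omega>"
    "\<And>a. \<exists>s\<in>{a..a + 1}. Zfbm \<alpha> B t \<omega> - Zfbm \<alpha> B s \<omega> \<ge> ln x - ln 2"
proof -
  define Z where "Z t = Zfbm \<alpha> B t \<omega>" for t
  have exp_less: "2 * exp (Z t) / x < exp (Z s)" if "Z t - Z s < ln x - ln 2" for t s
  proof -
    have "2 * exp (Z t) / x = exp (ln 2 + Z t - ln x)"
      using x by (simp add: exp_add exp_diff)
    also have "\<dots> < exp (Z s)"
      using that by simp
    finally show ?thesis .
  qed
  have "\<exists>t. Z t \<ge> Z 0 \<and> (\<forall>a. \<exists>s\<in>{a..a + 1}. Z t - Z s \<ge> ln x - ln 2)"
  proof (cases "\<delta> = 0")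
    case True
    let ?I = "integral\<^sup>L lborel (\<lambda>t. exp (Z t))"
    have gt': "Sup (range (\<lambda>t. exp (Z t))) / ?I > x"
      using gt by (simp add: xi_def True Z_def)
    \<comment> \<open>Without integrability the denominator would be the default 0 and so would the
      quotient; \<open>infsum\<close> behaves alike in the grid case.\<close>
    have int: "integrable lborel (\<lambda>t. exp (Z t))"
      using gt' x by (cases "integrable lborel (\<lambda>t. exp (Z t))") (auto simp: not_integrable_integral_eq)
    obtain t where t: "exp (Z t) > x * ?I" "exp (Z t) \<ge> exp (Z 0)"
      using Sup_divide_greaterD[OF gt', of 0] x by auto
    have "\<exists>s\<in>{a..a + 1}. Z t - Z s \<ge> ln x - ln 2" for a
    proof (rule ccontr)
      assume "\<not> ?thesis"
      then have less: "2 * exp (Z t) / x < exp (Z s)" if "s \<in> {a..a + 1}" for s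
        using that exp_less by (auto simp: not_le)
      have "(\<integral>s. 2 * exp (Z t) / x * indicator {a..a + 1} s \<partial>lborel) \<le> ?I"
      proof (rule integral_mono)
        show "integrable lborel (\<lambda>s. 2 * exp (Z t) / x * indicator {a..a + 1} s)"
          by (intro integrable_mult_right integrable_real_indicator) auto
        show "2 * exp (Z t) / x * indicator {a..a + 1} s \<le> exp (Z s)" for s
          using less[of s] by (cases "s \<in> {a..a + 1}") auto
      qed (rule int)
      then have "2 * exp (Z t) / x \<le> ?I"
        by simp
      then have "2 * exp (Z t) \<le> x * ?I"
        using x by (simp add: field_simps)
      with t(1) show False
        using exp_gt_zero[of "Z t"] by linarith
    qed
    with t(2) show ?thesis
      by auto
  next
    case False
    with \<delta> have \<delta>: "0 < \<delta>" "\<delta> \<le> 1"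
      by auto
    let ?f = "\<lambda>k::int. exp (Z (\<delta> * of_int k))"
    have gt': "Sup (range ?f) / (\<delta> * infsum ?f UNIV) > x"
      using gt False by (simp add: xi_def Z_def)
    have sum: "?f summable_on UNIV"
      using gt' x by (cases "?f summable_on UNIV") (auto simp: infsum_not_exists)
    have "0 \<le> \<delta> * infsum ?f UNIV"
      using \<delta> by (intro mult_nonneg_nonneg infsum_nonneg) auto
    then obtain k where k: "?f k > x * (\<delta> * infsum ?f UNIV)" "?f k \<ge> ?f 0"
      using Sup_divide_greaterD[OF gt', of 0] x by auto
    let ?t = "\<delta> * of_int k"
    have "\<exists>s\<in>{a..a + 1}. Z ?t - Z s \<ge> ln x - ln 2" for a
    proof (rule ccontr)
      assume "\<not> ?thesis"
      then have less: "2 * exp (Z ?t) / x < exp (Z s)" if "s \<in> {a..a + 1}" for s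
        using that exp_less by (auto simp: not_le)
      let ?J = "{k::int. \<delta> * of_int k \<in> {a..a + 1}}"
      note J = grid_points_in_unit_interval[OF \<delta>, of a]
      have "exp (Z ?t) / x = 1 / 2 * (2 * exp (Z ?t) / x)"
        by simp
      also have "\<dots> \<le> \<delta> * real (card ?J) * (2 * exp (Z ?t) / x)"
        using x by (intro mult_right_mono J) auto
      also have "\<dots> = \<delta> * (\<Sum>k\<in>?J. 2 * exp (Z ?t) / x)"
        by simp
      also have "\<dots> \<le> \<delta> * (\<Sum>k\<in>?J. ?f k)"
        using \<delta> less by (intro mult_left_mono sum_mono less_imp_le) auto
      also have "\<dots> \<le> \<delta> * infsum ?f UNIV"
        using \<delta> by (intro mult_left_mono finite_sum_le_infsum sum J) auto
      finally have "exp (Z ?t) \<le> x * (\<delta> * infsum ?f UNIV)"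
        using x by (simp add: field_simps)
      with k(1) show False
        by simp
    qed
    with k(2) show ?thesis
      by (intro exI[of _ ?t]) auto
  qed
  with that show ?thesis
    unfolding Z_def by blast
qed

text \<open>The choice of \<open>u n\<close> turns \<open>not_bad_bound\<close> into
  \<open>v n \<le> v n / 2\<close>, so some bad event must occur. In the exponent
  \<open>v n / (16 * D)\<close> the part with \<open>n\<close> is summed and the part with
  \<open>x\<close> is kept; the factor 2 counts both signs.\<close>

lemma prob_xi_greater_le:
  fixes x \<delta> :: real
  defines "D \<equiv> (drift_const \<alpha>)\<^sup>2 + (osc_const \<alpha>)\<^sup>2"
  assumes x: "1 \<le> x" and \<delta>: "\<delta> \<in> {0..1}" and large: "2 * D \<le> (ln x)\<^sup>2" and D: "0 < D"
  shows "prob {\<omega> \<in> space M. xi \<alpha> B \<delta> \<omega> > x} \<le>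
    2 * tail_const \<alpha> * (\<Sum>n. exp (- (1 / (16 * D) * (1 + real n) powr \<alpha>))) * exp (- (1 / (16 * D)) * (ln x)\<^sup>2)"
proof -
  define v where "v n = (1 + real n) powr \<alpha> + (ln x)\<^sup>2" for n
  define u where "u n = sqrt (v n / (2 * D))" for n
  \<comment> \<open>This is where \<open>large\<close> enters: it yields
    \<open>1 \<le> u n\<close>.\<close>
  have v: "2 * D \<le> v n" for n
    using large by (simp add: v_def add_increasing)
  have u: "1 \<le> u n" and u2: "(u n)\<^sup>2 = v n / (2 * D)" for n
    using v[of n] D by (auto simp: u_def)
  let ?f = "\<lambda>n. exp (- (1 / (16 * D) * (1 + real n) powr \<alpha>))" and ?E = "exp (- (1 / (16 * D)) * (ln x)\<^sup>2)"
  have sm: "summable ?f"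
    using D \<alpha>_pos by (intro summable_exp_minus_powr) auto
  have bad: "prob (\<Union>n. bad \<sigma> n (u n)) \<le> tail_const \<alpha> * (\<Sum>n. ?f n) * ?E" if \<sigma>: "\<bar>\<sigma>\<bar> = 1" for \<sigma>
  proof -
    have "prob (bad \<sigma> n (u n)) \<le> tail_const \<alpha> * ?E * ?f n" for n
    proof -
      have "prob (bad \<sigma> n (u n)) \<le> tail_const \<alpha> * exp (- (u n)\<^sup>2 / 8)"
        by (rule prob_bad_le[OF u \<sigma>])
      also have "- (u n)\<^sup>2 / 8 = - (1 / (16 * D)) * (ln x)\<^sup>2 + - (1 / (16 * D) * (1 + real n) powr \<alpha>)"
        using D by (simp add: u2 v_def field_simps)
      finally show ?thesis
        by (simp only: exp_add mult.assoc)
    qed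
    then have "prob (\<Union>n. bad \<sigma> n (u n)) \<le> (\<Sum>n. tail_const \<alpha> * ?E * ?f n)"
      by (intro measure_UN_le_suminf summable_mult sm sets_bad)
    also have "\<dots> = tail_const \<alpha> * ?E * (\<Sum>n. ?f n)"
      by (rule suminf_mult[OF sm])
    finally show ?thesis
      by (simp add: mult_ac)
  qed
  have "{\<omega> \<in> space M. xi \<alpha> B \<delta> \<omega> > x} \<subseteq> (\<Union>n. bad 1 n (u n)) \<union> (\<Union>n. bad (-1) n (u n))"
  proof safe
    fix \<omega> assume \<omega>: "\<omega> \<in> space M" and gt: "xi \<alpha> B \<delta> \<omega> > x" and nb: "\<omega> \<notin> (\<Union>n. bad (-1) n (u n))"
    obtain t where t: "Zfbm \<alpha> B t \<omega> \<ge> Zfbm \<alpha> B 0 \<omega>"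
      "\<And>a. \<exists>s\<in>{a..a + 1}. Zfbm \<alpha> B t \<omega> - Zfbm \<alpha> B s \<omega> \<ge> ln x - ln 2"
      using xi_greaterD[OF x \<delta> gt] by blast
    obtain \<sigma> a n where \<sigma>: "\<sigma> \<in> {1, -1}" and a: "t \<in> {a..a + 1}"
      and cover: "\<And>s. s \<in> {a..a + 1} \<Longrightarrow> \<exists>\<tau>\<in>{0..1}. s = \<sigma> * (real n + \<tau>)"
      using unit_interval_cover[of t] by blast
    obtain s where s: "s \<in> {a..a + 1}" "Zfbm \<alpha> B t \<omega> - Zfbm \<alpha> B s \<omega> \<ge> ln x - ln 2"
      using t(2) by blast
    obtain \<tau> \<tau>' where \<tau>: "\<tau> \<in> {0..1}" "\<tau>' \<in> {0..1}" "t = \<sigma> * (real n + \<tau>)" "s = \<sigma> * (real n + \<tau>')"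
      using cover[OF a] cover[OF s(1)] by blast
    have "\<omega> \<in> bad \<sigma> n (u n)"
    proof (rule ccontr)
      assume "\<omega> \<notin> bad \<sigma> n (u n)"
      then have "v n \<le> D * (u n)\<^sup>2"
        unfolding v_def D_def using \<sigma> t(1) s(2) \<tau>
        by (intro not_bad_bound[OF \<omega> _ _ u x \<tau>(1,2)]) auto
      also have "\<dots> = v n / 2"
        using D by (simp add: u2)
      finally show False
        using v[of n] D by simp
    qed
    with \<sigma> nb show "\<omega> \<in> (\<Union>n. bad 1 n (u n))"
      by auto
  qed
  then have "prob {\<omega> \<in> space M. xi \<alpha> B \<delta> \<omega> > x} \<le> prob ((\<Union>n. bad 1 n (u n)) \<union> (\<Union>n. bad (-1) n (u n)))"
    by (intro finite_measure_mono) auto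
  also have "\<dots> \<le> prob (\<Union>n. bad 1 n (u n)) + prob (\<Union>n. bad (-1) n (u n))"
    by (intro measure_Un_le) auto
  also have "\<dots> \<le> 2 * tail_const \<alpha> * (\<Sum>n. ?f n) * ?E"
    using bad[of 1] bad[of "-1"] by simp
  finally show ?thesis .
qed

end

theorem theorem2p3:
  fixes \<alpha> :: real
  assumes "0 < \<alpha>" and "\<alpha> < 2"
  shows "\<exists>C1>0. \<exists>C2>0. \<forall>(M::'a measure) B. is_fBm M \<alpha> B \<longrightarrow>
           (\<forall>x\<ge>1. \<forall>\<delta>\<in>{0..1}.
              {\<omega>\<in>space M. xi \<alpha> B \<delta> \<omega> > x} \<in> sets M \<and>
              measure M {\<omega>\<in>space M. xi \<alpha> B \<delta> \<omega> > x} \<le> C1 * exp (- C2 * (ln x)\<^sup>2))"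
proof -
  \<comment> \<open>All constants depend on \<alpha> alone, hence are uniform in the process and in
    \<delta>.\<close>
  define D where "D = (drift_const \<alpha>)\<^sup>2 + (osc_const \<alpha>)\<^sup>2"
  define c where "c = 1 / (16 * D)"
  define K where "K = 2 * tail_const \<alpha> * (\<Sum>n. exp (- (c * (1 + real n) powr \<alpha>)))"
  have "chain_rate \<alpha> < 1"
    using assms by (simp add: chain_rate_def powr_less_one)
  then have "2 \<le> drift_const \<alpha>"
    by (simp add: drift_const_def)
  then have D: "0 < D"
    by (simp add: D_def add_pos_nonneg)
  then have c: "0 < c"
    by (simp add: c_def)
  \<comment> \<open>The second entry makes the claimed bound at least 1 when
    \<open>(ln x)\<^sup>2 < 2 * D\<close>, where \<open>prob_xi_greater_le\<close> does not
    apply.\<close>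
  define C where "C = max K (exp (c * (2 * D)))"
  have "C > 0"
    by (simp add: C_def less_max_iff_disj)
  moreover have "{\<omega>\<in>space M. xi \<alpha> B \<delta> \<omega> > x} \<in> sets M \<and>
      measure M {\<omega>\<in>space M. xi \<alpha> B \<delta> \<omega> > x} \<le> C * exp (- c * (ln x)\<^sup>2)"
    if fBm: "is_fBm M \<alpha> B" and x: "1 \<le> x" and \<delta>: "\<delta> \<in> {0..1}" for M :: "'a measure" and B x \<delta>
  proof
    interpret prob_space M
      using fBm by (simp add: is_fBm_def)
    interpret fBm M \<alpha> B
      using fBm assms by unfold_locales
    show "{\<omega>\<in>space M. xi \<alpha> B \<delta> \<omega> > x} \<in> sets M"
      by measurable
    show "prob {\<omega>\<in>space M. xi \<alpha> B \<delta> \<omega> > x} \<le> C * exp (- c * (ln x)\<^sup>2)"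
    proof (cases "2 * D \<le> (ln x)\<^sup>2")
      case True
      have "prob {\<omega>\<in>space M. xi \<alpha> B \<delta> \<omega> > x} \<le> K * exp (- c * (ln x)\<^sup>2)"
        using prob_xi_greater_le[OF x \<delta>] True D unfolding K_def c_def D_def by blast
      also have "\<dots> \<le> C * exp (- c * (ln x)\<^sup>2)"
        by (intro mult_right_mono) (auto simp: C_def)
      finally show ?thesis .
    next
      case False
      have "prob {\<omega>\<in>space M. xi \<alpha> B \<delta> \<omega> > x} \<le> 1"
        by (rule prob_le_1)
      also have "1 \<le> exp (c * (2 * D) + - c * (ln x)\<^sup>2)"
        using False c by (simp add: mult_left_mono)
      also have "\<dots> \<le> C * exp (- c * (ln x)\<^sup>2)"
        unfolding exp_add by (intro mult_right_mono) (auto simp: C_def)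
      finally show ?thesis .
    qed
  qed
  ultimately show ?thesis
    using c by blast
qed

end
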